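(* Let $(K,v)$ be a field with valuation with value group $\Gamma$, let $w\in\Gamma^n$, let $\prec$ be a monomial order on $K[x_1,\ldots,x_n]$, and let $d\ge 1$. Let $f\in K[x_1,\ldots,x_n]^d$ be a homogeneous element and let $S=\{g_1,\ldots,g_s\}$ be a set of homogeneous elements of $K[x_1,\ldots,x_n]^d$. Then the division algorithm for modules written out in the context, applied to $f$ and $g_1,\ldots,g_s$, computes (in particular, it terminates with) $r\in K[x_1,\ldots,x_n]^d$ and $h_1,\ldots,h_s\in K[x_1,\ldots,x_n]$ such that $$f=\sum_{i=1}^{s}h_ig_i+r,$$ where $\operatorname{in}_{w,\prec}(r)\ge \operatorname{in}_{w,\prec}(f)$, $\operatorname{in}_{w,\prec}(h_ig_i)\ge \operatorname{in}_{w,\prec}(f)$ for every $i\in\{1,\ldots,s\}$, and no monomial of $r$ is divisible by $\operatorname{in}_{w,\prec}(g_i)$ for any $i\in\{1,\ldots,s\}$.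
   Context: A field with valuation is a field $K$ with a function $v:K\to\mathbb{R}\cup\{\infty\}$ such that $v$ restricts to a group homomorphism $K^*\to(\mathbb{R},+)$, $v(a+b)\ge\min\{v(a),v(b)\}$, and $v(a)=\infty$ iff $a=0$. Its value group is $\Gamma=v(K^* )$. Let $e_1,\ldots,e_d$ be the standard basis of $K[x_1,\ldots,x_n]^d$. Every element is a finite sum $f=\sum c_{u,k}x^ue_k$ with $u\in\mathbb{Z}_{\ge0}^n$, $k\in\{1,\ldots,d\}$, $c_{u,k}\in K$; $c_{u,k}x^ue_k$ is called a term, $x^ue_k$ a monomial, of degree $|u|=u_1+\cdots+u_n$, and $\operatorname{supp}(f)=\{(u,k):c_{u,k}\ne0\}$. The monomials of $f$ are the $x^ue_k$ with $(u,k)\in\operatorname{supp}(f)$. An element is homogeneous if all its monomials have the same degree. Monomials of the module are ordered by: $x^\alpha e_i\prec x^\beta e_j$ if $x^\alpha\prec x^\beta$, or $x^\alpha=x^\beta$ and $e_i\prec e_j$, where $e_1\prec e_2\prec\cdots\prec e_d$. For $f\neq 0$, put $W=\min_{(u,k)\in\operatorname{supp}(f)}\{v(c_{u,k})+w\cdot u\}$. Then $\operatorname{in}_{w,\prec}(f)$ is the term $c_{u,k}x^ue_k$ of $f$ whose monomial $x^ue_k$ is the $\prec$-largest among those with $v(c_{u,k})+w\cdot u=W$. Nonzero terms are compared as follows: $ax^\alpha e_i<bx^\beta e_j$ if $v(a)+w\cdot\alpha<v(b)+w\cdot\beta$, or if $v(a)+w\cdot\alpha=v(b)+w\cdot\beta$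 and $x^\alpha e_i\succ x^\beta e_j$; and $t\ge t'$ means that $t<t'$ does not hold. By convention $\operatorname{in}_{w,\prec}(0)=0$ is larger than every nonzero term, $0\ge 0$, and $0$ divides no nonzero term or monomial. A nonzero term $bx^\beta e_j$ divides a term or monomial $ax^\alpha e_i$ if $i=j$ and $bx^\beta$ divides $ax^\alpha$ in $K[x_1,\ldots,x_n]$; the quotient $ax^\alpha e_i/(bx^\beta e_i)$ is then $(a/b)x^{\alpha-\beta}$. For $a,b\in K[x_1,\ldots,x_n]^d$, $\operatorname{ecart}(a,b)=|\operatorname{supp}(b)\setminus\operatorname{supp}(a)|$. Division algorithm for modules. Input: $f$ and $g_1,\ldots,g_s$. Initialize $D=\{g_1,\ldots,g_s\}$, $h_1=\cdots=h_s=0$, $q=f$, $r=0$. While $q\ne0$, do the following. (1) If there is no $g\in D$ with $\operatorname{in}_{w,\prec}(g)$ dividing $\operatorname{in}_{w,\prec}(q)$: replace $D$ by $D\cup\{q\}$, then replace $r$ by $r+\operatorname{in}_{w,\prec}(q)$ and $q$ by $q-\operatorname{in}_{w,\prec}(q)$. (2) Otherwise choose $g\in D$ such that $\operatorname{in}_{w,\prec}(g)$ divides $\operatorname{in}_{w,\prec}(q)$ with $\operatorname{ecart}(g,q)$ minimal. If $\operatorname{ecart}(g,q)>0$, replace $D$ by $D\cup\{q\}$. Put $c=\operatorname{in}_{w,\prec}(q)/\operatorname{in}_{w,\prec}(g)$ and $l=q-cg$. (2a) If $g=g_k$ for some $k\in\{1,\ldots,s\}$: replace $q$ by $l$ and $h_k$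 by $h_k+c$, leaving $h_i$ ($i\ne k$) and $r$ unchanged. (2b) Otherwise $g=q_m$ is the value of $q$ at some earlier iteration $m$, at which it was put into $D$; let $h_{k,m}$ and $r_m$ be the corresponding values of $h_k$ and $r$, so that $f=q_m+\sum_{k}h_{k,m}g_k+r_m$. Replace $q$ by $\frac{1}{1-c}\,l$, each $h_k$ by $\frac{1}{1-c}(h_k-c\,h_{k,m})$, and $r$ by $\frac{1}{1-c}(r-c\,r_m)$. When $q=0$, return $r$ (together with $h_1,\ldots,h_s$).
   Formalization: In step (2) the arguments of ecart are swapped: g minimizes ecart(q,g)=|supp(g)\supp(q)|, and q joins D if this is positive; with ecart(g,q) the algorithm can loop forever (p-adic Q, w=0, f=y, g_1=x+py, g_2=y+px). *)

theory Defs
  imports "HOL-Analysis.Finite_Cartesian_Product" "HOL-Library.Poly_Mapping" "HOL-Library.Extended_Real"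
begin

text \<open>
  The ring $K[x_1,\ldots,x_n]$ is the type of finitely supported functions from exponent vectors
  to coefficients; the variables are indexed by a finite type \<open>'n\<close>. The free module of
  rank $d$ is the type of vectors over this ring indexed by a finite linearly ordered type
  \<open>'d\<close>, the order on \<open>'d\<close> being $e_1 \prec \cdots \prec e_d$. Scalar
  multiplication is the library's \<open>*s\<close>.
\<close>

type_synonym 'n expo = "'n \<Rightarrow>\<^sub>0 nat"
type_synonym ('n, 'k) mpoly = "'n expo \<Rightarrow>\<^sub>0 'k"
type_synonym ('n, 'k, 'd) pmod = "(('n, 'k) mpoly, 'd) vec"

section \<open>Valuations and monomial orders\<close>

definition valuation :: "('k::field \<Rightarrow> ereal) \<Rightarrow> bool" where
  "valuation v \<longleftrightarrow>
     (\<forall>a. v a \<noteq> -\<infinity>) \<and>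
     (\<forall>a. v a = \<infinity> \<longleftrightarrow> a = 0) \<and>
     (\<forall>a b. a \<noteq> 0 \<longrightarrow> b \<noteq> 0 \<longrightarrow> v (a * b) = v a + v b) \<and>
     (\<forall>a b. min (v a) (v b) \<le> v (a + b))"

definition value_group :: "('k::field \<Rightarrow> ereal) \<Rightarrow> real set" where
  "value_group v = {\<gamma>. \<exists>a. a \<noteq> 0 \<and> v a = ereal \<gamma>}"

definition monomial_order :: "('n expo \<Rightarrow> 'n expo \<Rightarrow> bool) \<Rightarrow> bool" where
  "monomial_order lt \<longleftrightarrow>
     irreflp lt \<and> transp lt \<and> totalp lt \<and>
     (\<forall>\<alpha>. \<alpha> \<noteq> 0 \<longrightarrow> lt 0 \<alpha>) \<and>
     (\<forall>\<alpha> \<beta> \<gamma>. lt \<alpha> \<beta> \<longrightarrow> lt (\<alpha> + \<gamma>) (\<beta> + \<gamma>))"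

text \<open>The module monomial $x^\alpha e_i$ is encoded as the pair \<open>(\<alpha>, i)\<close>.\<close>

fun mon_less :: "('n expo \<Rightarrow> 'n expo \<Rightarrow> bool) \<Rightarrow> 'n expo \<times> 'd::linorder \<Rightarrow> 'n expo \<times> 'd \<Rightarrow> bool" where
  "mon_less lt (\<alpha>, i) (\<beta>, j) \<longleftrightarrow> lt \<alpha> \<beta> \<or> (\<alpha> = \<beta> \<and> i < j)"

section \<open>Supports, homogeneous elements and terms\<close>

definition coefficient :: "('n, 'k::zero, 'd::finite) pmod \<Rightarrow> 'n expo \<times> 'd \<Rightarrow> 'k" where
  "coefficient f m = Poly_Mapping.lookup (f $ snd m) (fst m)"

definition supp :: "('n, 'k::zero, 'd::finite) pmod \<Rightarrow> ('n expo \<times> 'd) set" where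
  "supp f = {m. coefficient f m \<noteq> 0}"

definition total_degree :: "'n::finite expo \<Rightarrow> nat" where
  "total_degree u = (\<Sum>i\<in>UNIV. Poly_Mapping.lookup u i)"

definition homogeneous :: "('n::finite, 'k::zero, 'd::finite) pmod \<Rightarrow> bool" where
  "homogeneous f \<longleftrightarrow> (\<exists>e. \<forall>m\<in>supp f. total_degree (fst m) = e)"

definition ecart :: "('n, 'k::zero, 'd::finite) pmod \<Rightarrow> ('n, 'k, 'd) pmod \<Rightarrow> nat" where
  "ecart a b = card (supp b - supp a)"

text \<open>The module element $c x^u e_k$.\<close>

definition mterm :: "'k::zero \<Rightarrow> 'n expo \<Rightarrow> 'd::finite \<Rightarrow> ('n, 'k, 'd) pmod" where
  "mterm c u k = axis k (Poly_Mapping.single u c)"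

definition weight_dot :: "real ^ 'n \<Rightarrow> 'n::finite expo \<Rightarrow> real" where
  "weight_dot w u = (\<Sum>i\<in>UNIV. w $ i * real (Poly_Mapping.lookup u i))"

definition term_val :: "('k \<Rightarrow> ereal) \<Rightarrow> real ^ 'n \<Rightarrow> 'k \<Rightarrow> 'n::finite expo \<Rightarrow> ereal" where
  "term_val v w c u = v c + ereal (weight_dot w u)"

section \<open>Initial terms, comparison and division of terms\<close>

definition min_val :: "('k::zero \<Rightarrow> ereal) \<Rightarrow> real ^ 'n \<Rightarrow> ('n::finite, 'k, 'd::finite) pmod \<Rightarrow> ereal" where
  "min_val v w f = Min ((\<lambda>m. term_val v w (coefficient f m) (fst m)) ` supp f)"

definition initial_monomial :: "('k::zero \<Rightarrow> ereal) \<Rightarrow> real ^ 'n \<Rightarrow> ('n expo \<Rightarrow> 'n expo \<Rightarrow> bool) \<Rightarrow>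
    ('n::finite, 'k, 'd::{finite, linorder}) pmod \<Rightarrow> 'n expo \<times> 'd" where
  "initial_monomial v w lt f =
     (let M = {m \<in> supp f. term_val v w (coefficient f m) (fst m) = min_val v w f}
      in THE m. m \<in> M \<and> (\<forall>m'\<in>M. m' \<noteq> m \<longrightarrow> mon_less lt m' m))"

definition initial_term :: "('k::zero \<Rightarrow> ereal) \<Rightarrow> real ^ 'n \<Rightarrow> ('n expo \<Rightarrow> 'n expo \<Rightarrow> bool) \<Rightarrow>
    ('n::finite, 'k, 'd::{finite, linorder}) pmod \<Rightarrow> ('n, 'k, 'd) pmod" where
  "initial_term v w lt f =
     (if f = 0 then 0
      else (let m = initial_monomial v w lt f in mterm (coefficient f m) (fst m) (snd m)))"

text \<open>The element \<open>0\<close> counts as a term that is larger than every nonzero term.\<close>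

definition term_less :: "('k::zero \<Rightarrow> ereal) \<Rightarrow> real ^ 'n \<Rightarrow> ('n expo \<Rightarrow> 'n expo \<Rightarrow> bool) \<Rightarrow>
    ('n::finite, 'k, 'd::{finite, linorder}) pmod \<Rightarrow> ('n, 'k, 'd) pmod \<Rightarrow> bool" where
  "term_less v w lt s t \<longleftrightarrow>
     (\<exists>a \<alpha> i. a \<noteq> 0 \<and> s = mterm a \<alpha> i \<and>
        (t = 0 \<or>
         (\<exists>b \<beta> j. b \<noteq> 0 \<and> t = mterm b \<beta> j \<and>
            (term_val v w a \<alpha> < term_val v w b \<beta> \<or>
             (term_val v w a \<alpha> = term_val v w b \<beta> \<and> mon_less lt (\<beta>, j) (\<alpha>, i))))))"

definition term_ge :: "('k::zero \<Rightarrow> ereal) \<Rightarrow> real ^ 'n \<Rightarrow> ('n expo \<Rightarrow> 'n expo \<Rightarrow> bool) \<Rightarrow>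
    ('n::finite, 'k, 'd::{finite, linorder}) pmod \<Rightarrow> ('n, 'k, 'd) pmod \<Rightarrow> bool" where
  "term_ge v w lt t t' \<longleftrightarrow> \<not> term_less v w lt t t'"

definition term_dvd :: "('n, 'k::field, 'd::finite) pmod \<Rightarrow> ('n, 'k, 'd) pmod \<Rightarrow> bool" where
  "term_dvd s t \<longleftrightarrow>
     (\<exists>b \<beta> a \<alpha> i. b \<noteq> 0 \<and> a \<noteq> 0 \<and> s = mterm b \<beta> i \<and> t = mterm a \<alpha> i \<and>
        Poly_Mapping.single \<beta> b dvd Poly_Mapping.single \<alpha> a)"

definition term_quot :: "('n, 'k::field, 'd::finite) pmod \<Rightarrow> ('n, 'k, 'd) pmod \<Rightarrow> ('n, 'k) mpoly" where
  "term_quot t s = (THE c. \<exists>a \<alpha> b \<beta> i. a \<noteq> 0 \<and> b \<noteq> 0 \<and> t = mterm a \<alpha> i \<and> s = mterm b \<beta> i \<and>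
     c = Poly_Mapping.single (\<alpha> - \<beta>) (a / b))"

section \<open>The division algorithm\<close>

text \<open>
  The algorithm makes choices, so it is given as a transition relation between configurations.
  \<open>Run D M h q r\<close> carries the variables of the algorithm; \<open>M\<close> records the triple of
  values of \<open>q\<close>, \<open>h\<close>, \<open>r\<close> at the beginning of every earlier iteration that put its
  \<open>q\<close> into \<open>D\<close>. \<open>Undefined\<close> is reached when an iteration asks for $1/(1-c)$ and $1-c$ is not
  invertible in the polynomial ring; such a computation must not count as a successful one.
\<close>

datatype ('m, 'p) config =
    Run "'m set" "('m \<times> (nat \<Rightarrow> 'p) \<times> 'm) set" "nat \<Rightarrow> 'p" 'm 'm
  | Undefined

definition initial_config :: "(nat \<Rightarrow> 'm) \<Rightarrow> nat \<Rightarrow> 'm::zero \<Rightarrow> ('m, 'p::zero) config" where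
  "initial_config g s f = Run (g ` {1..s}) {} (\<lambda>k. 0) f 0"

text \<open>
  The divisor is selected by \<open>ecart q p\<close>, the number of monomials of \<open>p\<close> that do not
  occur in \<open>q\<close>, so that subtracting a scalar multiple of \<open>p\<close> with ecart 0 introduces no
  new monomial. The order of the two arguments matters: with \<open>ecart p q\<close> in its place the
  algorithm need not terminate. For a prime $p$, the $p$-adic valuation on the rationals and
  $w = 0$, divide $y$ by $x + py$ and $y + px$: the monomial of \<open>q\<close> always occurs in the
  divisor, nothing is ever put into \<open>D\<close>, and \<open>q\<close> runs through $y$, $-px$, $p^2y$,
  $-p^3x$, and so on.
\<close>

definition chosen_divisor :: "('k::field \<Rightarrow> ereal) \<Rightarrow> real ^ 'n \<Rightarrow> ('n expo \<Rightarrow> 'n expo \<Rightarrow> bool) \<Rightarrow>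
    ('n::finite, 'k, 'd::{finite, linorder}) pmod set \<Rightarrow> ('n, 'k, 'd) pmod \<Rightarrow> ('n, 'k, 'd) pmod \<Rightarrow> bool" where
  "chosen_divisor v w lt D q p \<longleftrightarrow>
     is_arg_min (\<lambda>p. ecart q p)
       (\<lambda>p. p \<in> D \<and> term_dvd (initial_term v w lt p) (initial_term v w lt q)) p"

inductive div_step :: "('k::field \<Rightarrow> ereal) \<Rightarrow> real ^ 'n \<Rightarrow> ('n expo \<Rightarrow> 'n expo \<Rightarrow> bool) \<Rightarrow>
    (nat \<Rightarrow> ('n::finite, 'k, 'd::{finite, linorder}) pmod) \<Rightarrow> nat \<Rightarrow>
    (('n, 'k, 'd) pmod, ('n, 'k) mpoly) config \<Rightarrow> (('n, 'k, 'd) pmod, ('n, 'k) mpoly) config \<Rightarrow> bool"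
  for v w lt g s where
  no_divisor:
    "\<lbrakk> q \<noteq> 0;
       \<not> (\<exists>p\<in>D. term_dvd (initial_term v w lt p) (initial_term v w lt q)) \<rbrakk>
     \<Longrightarrow> div_step v w lt g s (Run D M h q r)
           (Run (insert q D) (insert (q, h, r) M) h
              (q - initial_term v w lt q) (r + initial_term v w lt q))"
| by_input:
    "\<lbrakk> q \<noteq> 0; chosen_divisor v w lt D q p;
       D' = (if ecart q p > 0 then insert q D else D);
       M' = (if ecart q p > 0 then insert (q, h, r) M else M);
       c = term_quot (initial_term v w lt q) (initial_term v w lt p);
       k \<in> {1..s}; p = g k \<rbrakk>
     \<Longrightarrow> div_step v w lt g s (Run D M h q r)
           (Run D' M' (h(k := h k + c)) (q - c *s p) r)"
| by_earlier:
    "\<lbrakk> q \<noteq> 0; chosen_divisor v w lt D q p;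
       D' = (if ecart q p > 0 then insert q D else D);
       M' = (if ecart q p > 0 then insert (q, h, r) M else M);
       c = term_quot (initial_term v w lt q) (initial_term v w lt p);
       p \<notin> g ` {1..s}; (p, h\<^sub>m, r\<^sub>m) \<in> M; e * (1 - c) = 1 \<rbrakk>
     \<Longrightarrow> div_step v w lt g s (Run D M h q r)
           (Run D' M' (\<lambda>k. e * (h k - c * h\<^sub>m k)) (e *s (q - c *s p)) (e *s (r - c *s r\<^sub>m)))"
| not_invertible:
    "\<lbrakk> q \<noteq> 0; chosen_divisor v w lt D q p;
       c = term_quot (initial_term v w lt q) (initial_term v w lt p);
       p \<notin> g ` {1..s}; \<not> (1 - c) dvd 1 \<rbrakk>
     \<Longrightarrow> div_step v w lt g s (Run D M h q r) Undefined"

end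

theory Submission
  imports Defs
begin

text \<open>
  Every dividend \<open>q\<close> of the algorithm is homogeneous of the degree of \<open>f\<close>, so only finitely
  many monomials ever occur in it, and its initial term strictly increases from each iteration to
  the next. These facts settle the two things that could go wrong.

  The inverse of $1 - c$ exists. If the divisor is an earlier dividend \<open>p\<close>, then \<open>p\<close> and \<open>q\<close> have
  the same degree, so divisibility of the initial terms forces their monomials to agree and \<open>c\<close> is a
  scalar. As the initial term of \<open>q\<close> is larger than that of \<open>p\<close> on the same monomial, $v(c) > 0$.
  Hence $v(1 - c) = 0$: the factor $1/(1 - c)$ is a scalar of valuation 0, and multiplying by it
  does not move any term in the order (\<open>sound_earlier_step\<close>).

  The algorithm terminates. Call the initial monomial of \<open>q\<close> together with its support its signature;
  there are finitely many signatures. When \<open>q\<close> is stored, its signature is new: a stored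
  element with the same signature would have been a possible divisor of ecart 0, whereas \<open>q\<close> is
  stored only if there is no divisor or the minimal ecart is positive (\<open>rank_record\<close>). When \<open>q\<close> is not
  stored, the divisor has ecart 0, that is, its support lies in that of \<open>q\<close>. Then it is subtracted
  with a scalar factor, which brings in no monomial and removes the initial one
  (\<open>supp_shrinks\<close>). So the pair of the number of unused signatures and the number of terms of \<open>q\<close>
  decreases lexicographically (\<open>div_step_preserves_invariant\<close>).

  The bounds on initial terms hold because the elements whose terms are all at least some given
  term form a group closed under scalars of nonnegative valuation (\<open>terms_in_diff\<close>,
  \<open>terms_in_smult_scalar\<close>). A step that divides by an earlier dividend forms an affine combination,
  with coefficients $1/(1 - c)$ and $-c/(1 - c)$ in the valuation ring, of the current and
  the stored decomposition of \<open>f\<close>; such combinations preserve everything that is claimed about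
  \<open>h\<close> and \<open>r\<close> (\<open>sound_affine_combination\<close>).
\<close>

section \<open>Module elements and their terms\<close>

lemma coefficient_add: "coefficient (x + y) m = coefficient x m + coefficient y m"
  by (simp add: coefficient_def lookup_add)

lemma coefficient_diff: "coefficient (x - y) m = coefficient x m - coefficient y m"
  by (simp add: coefficient_def lookup_minus)

lemma coefficient_mterm: "coefficient (mterm c u k) m = (if m = (u, k) then c else 0)"
  by (cases m) (auto simp: coefficient_def mterm_def axis_def lookup_single when_def)

lemma supp_zero [simp]: "supp 0 = {}"
  by (simp add: supp_def coefficient_def)

lemma supp_eq_empty_iff: "supp x = {} \<longleftrightarrow> x = 0"
proof
  assume "supp x = {}"
  then have "Poly_Mapping.lookup (x $ k) u = 0" for k u
    by (auto simp: supp_def coefficient_def)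
  then show "x = 0" by (simp add: vec_eq_iff poly_mapping_eq_iff fun_eq_iff)
qed simp

lemma finite_supp: "finite (supp x)"
proof -
  have "supp x \<subseteq> (\<Union>k. (\<lambda>u. (u, k)) ` Poly_Mapping.keys (x $ k))"
    by (force simp: supp_def coefficient_def in_keys_iff)
  then show ?thesis by (rule finite_subset) simp
qed

lemma supp_add_subset: "supp (x + y) \<subseteq> supp x \<union> supp (y :: ('n, 'k::ab_group_add, 'd::finite) pmod)"
  by (auto simp: supp_def coefficient_add)

lemma supp_diff_subset: "supp (x - y) \<subseteq> supp x \<union> supp (y :: ('n, 'k::ab_group_add, 'd::finite) pmod)"
  by (auto simp: supp_def coefficient_diff)

lemma mterm_eq_iff:
  assumes "a \<noteq> 0"
  shows "mterm a \<alpha> i = mterm b \<beta> j \<longleftrightarrow> a = b \<and> \<alpha> = \<beta> \<and> i = j"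
  using assms by (metis coefficient_mterm prod.inject)

lemma lookup_single_times:
  fixes p :: "('n, 'k::field) mpoly"
  shows "Poly_Mapping.lookup (Poly_Mapping.single \<gamma> a * p) \<delta>
    = a * (Sum_any (\<lambda>\<beta>. Poly_Mapping.lookup p \<beta> when \<delta> = \<gamma> + \<beta>))"
  by (simp add: lookup_mult lookup_single when_mult)

lemma coefficient_smult_single:
  fixes x :: "('n, 'k::field, 'd::finite) pmod"
  shows "coefficient (Poly_Mapping.single \<gamma> a *s x) (\<gamma> + \<beta>, k) = a * coefficient x (\<beta>, k)"
proof -
  have "Sum_any (\<lambda>\<beta>'. Poly_Mapping.lookup (x $ k) \<beta>' when \<gamma> + \<beta> = \<gamma> + \<beta>') = Poly_Mapping.lookup (x $ k) \<beta>"
    by simp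
  then show ?thesis by (simp only: coefficient_def vector_smult_component lookup_single_times fst_conv snd_conv)
qed

lemma coefficient_smult_scalar:
  fixes x :: "('n, 'k::field, 'd::finite) pmod"
  shows "coefficient (Poly_Mapping.single 0 a *s x) m = a * coefficient x m"
  using coefficient_smult_single[of 0 a x "fst m" "snd m"] by simp

lemma supp_smult_scalar_subset:
  fixes x :: "('n, 'k::field, 'd::finite) pmod"
  shows "supp (Poly_Mapping.single 0 a *s x) \<subseteq> supp x"
  by (auto simp: supp_def coefficient_smult_scalar)

lemma supp_smult_singleE:
  fixes x :: "('n, 'k::field, 'd::finite) pmod"
  assumes "m \<in> supp (Poly_Mapping.single \<gamma> a *s x)"
  obtains \<beta> k where "m = (\<gamma> + \<beta>, k)" and "(\<beta>, k) \<in> supp x" and "a \<noteq> 0"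
proof -
  obtain \<delta> k where m: "m = (\<delta>, k)" by (cases m)
  have nz: "a * (Sum_any (\<lambda>\<beta>. Poly_Mapping.lookup (x $ k) \<beta> when \<delta> = \<gamma> + \<beta>)) \<noteq> 0"
    using assms by (simp add: m supp_def coefficient_def lookup_single_times)
  then obtain \<beta> where "\<delta> = \<gamma> + \<beta>"
    by (cases "\<exists>\<beta>. \<delta> = \<gamma> + \<beta>") auto
  with that show thesis
    using assms nz m by (auto simp: supp_def coefficient_smult_single)
qed

lemma single_dvd_single_iff:
  fixes a b :: "'k::field"
  assumes "a \<noteq> 0" and "b \<noteq> 0"
  shows "(Poly_Mapping.single \<beta> b :: ('n, 'k) mpoly) dvd Poly_Mapping.single \<alpha> a \<longleftrightarrow> (\<exists>\<gamma>. \<alpha> = \<gamma> + \<beta>)"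
proof
  assume "(Poly_Mapping.single \<beta> b :: ('n, 'k) mpoly) dvd Poly_Mapping.single \<alpha> a"
  then obtain p where p: "Poly_Mapping.single \<alpha> a = Poly_Mapping.single \<beta> b * p" by (rule dvdE)
  then have "b * (Sum_any (\<lambda>\<gamma>. Poly_Mapping.lookup p \<gamma> when \<alpha> = \<beta> + \<gamma>)) \<noteq> 0"
    unfolding lookup_single_times[symmetric] p[symmetric] using assms by simp
  then have "\<exists>\<gamma>. \<alpha> = \<beta> + \<gamma>"
    by (cases "\<exists>\<gamma>. \<alpha> = \<beta> + \<gamma>") auto
  then show "\<exists>\<gamma>. \<alpha> = \<gamma> + \<beta>" by (simp only: add.commute)
next
  assume "\<exists>\<gamma>. \<alpha> = \<gamma> + \<beta>"
  then obtain \<gamma> where "\<alpha> = \<gamma> + \<beta>" ..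
  then have "Poly_Mapping.single \<alpha> a = Poly_Mapping.single \<beta> b * Poly_Mapping.single \<gamma> (a / b)"
    using assms by (simp add: mult_single add.commute)
  then show "(Poly_Mapping.single \<beta> b :: ('n, 'k) mpoly) dvd Poly_Mapping.single \<alpha> a" ..
qed

lemma term_dvd_mterm_iff:
  fixes a b :: "'k::field"
  assumes "a \<noteq> 0" and "b \<noteq> 0"
  shows "term_dvd (mterm b \<beta> j) (mterm a \<alpha> i) \<longleftrightarrow> i = j \<and> (\<exists>\<gamma>. \<alpha> = \<gamma> + \<beta>)"
  unfolding term_dvd_def single_dvd_single_iff[OF assms, of \<beta> \<alpha>, symmetric]
  using assms by (auto simp: mterm_eq_iff)

lemma mterm_nonzero: "a \<noteq> 0 \<Longrightarrow> mterm a \<alpha> i \<noteq> 0"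
  using coefficient_mterm[of a \<alpha> i "(\<alpha>, i)"] by (auto simp: coefficient_def)

lemma not_term_dvd_zero [simp]: "\<not> term_dvd 0 t"
  unfolding term_dvd_def using mterm_nonzero by fastforce

lemma term_quot_mterm:
  fixes a b :: "'k::field"
  assumes "a \<noteq> 0" and "b \<noteq> 0"
  shows "term_quot (mterm a (\<gamma> + \<beta>) i) (mterm b \<beta> i) = Poly_Mapping.single \<gamma> (a / b)"
  unfolding term_quot_def
  by (rule the_equality) (use assms in \<open>auto simp: mterm_eq_iff\<close>)

lemma total_degree_add: "total_degree (u + u') = total_degree u + total_degree u'"
  by (simp add: total_degree_def lookup_add sum.distrib)

lemma total_degree_eq_0_iff: "total_degree u = 0 \<longleftrightarrow> u = 0"
  by (simp add: total_degree_def poly_mapping_eq_iff fun_eq_iff)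

lemma finite_monomials_of_degree:
  "finite {m :: 'n::finite expo \<times> 'd::finite. total_degree (fst m) = e}"
proof -
  define A where "A = {u :: 'n expo. total_degree u = e}"
  have "Poly_Mapping.lookup u i \<le> total_degree u" for u :: "'n expo" and i
    unfolding total_degree_def by (rule member_le_sum) simp_all
  then have "Poly_Mapping.lookup ` A
      \<subseteq> {h. \<forall>i. (i \<in> UNIV \<longrightarrow> h i \<in> {..e}) \<and> (i \<notin> UNIV \<longrightarrow> h i = 0)}"
    unfolding A_def by blast
  moreover have "finite {h :: 'n \<Rightarrow> nat. \<forall>i. (i \<in> UNIV \<longrightarrow> h i \<in> {..e}) \<and> (i \<notin> UNIV \<longrightarrow> h i = 0)}"
    by (rule finite_set_of_finite_funs) simp_all
  ultimately have "finite (Poly_Mapping.lookup ` A)"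
    by (rule finite_subset)
  then have "finite A"
    by (rule finite_imageD) (auto intro: inj_onI poly_mapping_eqI)
  then have "finite (A \<times> (UNIV :: 'd set))" by simp
  moreover have "{m :: 'n expo \<times> 'd. total_degree (fst m) = e} = A \<times> UNIV"
    by (auto simp: A_def)
  ultimately show ?thesis by simp
qed

section \<open>The order on terms and initial terms\<close>

locale valued_monomial_order =
  fixes v :: "'k::field \<Rightarrow> ereal"
    and w :: "real ^ 'n::finite"
    and lt :: "'n expo \<Rightarrow> 'n expo \<Rightarrow> bool"
  assumes valuation: "valuation v"
    and monomial_order: "monomial_order lt"
begin

lemma v_eq_infinity_iff: "v a = \<infinity> \<longleftrightarrow> a = 0"
  using valuation by (simp add: valuation_def)

lemma v_nonzeroE:
  assumes "a \<noteq> 0"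
  obtains \<gamma> where "v a = ereal \<gamma>"
  using assms valuation by (cases "v a") (auto simp: valuation_def)

lemma v_mult: "v (a * b) = v a + v b"
proof (cases "a = 0 \<or> b = 0")
  case True
  moreover have "v a \<noteq> - \<infinity>" "v b \<noteq> - \<infinity>" using valuation by (simp_all add: valuation_def)
  moreover have "v 0 = \<infinity>" using v_eq_infinity_iff by simp
  ultimately show ?thesis by (cases "v a"; cases "v b") auto
next
  case False
  then show ?thesis using valuation unfolding valuation_def by blast
qed

lemma v_add: "min (v a) (v b) \<le> v (a + b)"
  using valuation by (simp add: valuation_def)

lemma v_one: "v 1 = 0"
proof -
  obtain \<gamma> where "v 1 = ereal \<gamma>" by (rule v_nonzeroE[of 1]) auto
  with v_mult[of 1 1] show ?thesis by simp
qed

lemma v_uminus: "v (- a) = v a"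
proof -
  obtain \<gamma> where \<gamma>: "v (- 1) = ereal \<gamma>" by (rule v_nonzeroE[of "- 1"]) auto
  with v_mult[of "- 1" "- 1"] v_one have "v (- 1) = 0" by simp
  with v_mult[of "- 1" a] show ?thesis by simp
qed

lemma v_diff: "min (v a) (v b) \<le> v (a - b)"
  using v_add[of a "- b"] by (simp add: v_uminus)

text \<open>Of the summands \<open>1 - a\<close> and \<open>a\<close> of 1, one has valuation at most $v(1) = 0$, and it is not \<open>a\<close>.\<close>

lemma v_one_minus:
  assumes "0 < v a"
  shows "v (1 - a) = 0"
proof (rule antisym)
  show "0 \<le> v (1 - a)" using v_diff[of 1 a] assms by (simp add: v_one)
  show "v (1 - a) \<le> 0" using v_add[of "1 - a" a] assms by (auto simp: v_one min_le_iff_disj)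
qed

lemma v_inverse:
  assumes "v a = 0"
  shows "v (inverse a) = 0"
proof -
  have "a \<noteq> 0" using assms v_eq_infinity_iff[of a] by auto
  then show ?thesis using v_mult[of a "inverse a"] assms by (simp add: v_one)
qed

lemma lt_irrefl: "\<not> lt \<alpha> \<alpha>"
  and lt_trans: "lt \<alpha> \<beta> \<Longrightarrow> lt \<beta> \<gamma> \<Longrightarrow> lt \<alpha> \<gamma>"
  and lt_total: "\<alpha> \<noteq> \<beta> \<Longrightarrow> lt \<alpha> \<beta> \<or> lt \<beta> \<alpha>"
  and lt_shift: "lt \<alpha> \<beta> \<Longrightarrow> lt (\<alpha> + \<gamma>) (\<beta> + \<gamma>)"
  using monomial_order unfolding monomial_order_def
  by (auto dest: irreflpD transpD totalpD)

lemma mon_less_irrefl: "\<not> mon_less lt m m"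
  by (cases m) (simp add: lt_irrefl)

lemma mon_less_trans: "mon_less lt m m' \<Longrightarrow> mon_less lt m' m'' \<Longrightarrow> mon_less lt m m''"
  by (cases m; cases m'; cases m'') (auto dest: lt_trans)

lemma mon_less_total: "m \<noteq> m' \<Longrightarrow> mon_less lt m m' \<or> mon_less lt m' m"
  by (cases m; cases m') (auto dest: lt_total)

lemma mon_less_shift: "mon_less lt (\<alpha>, i) (\<beta>, j) \<Longrightarrow> mon_less lt (\<gamma> + \<alpha>, i) (\<gamma> + \<beta>, j)"
  using lt_shift[of \<alpha> \<beta> \<gamma>] by (simp add: add.commute[of \<gamma>]) blast

definition tv :: "('n, 'k, 'd::finite) pmod \<Rightarrow> 'n expo \<times> 'd \<Rightarrow> ereal" where
  "tv x m = term_val v w (coefficient x m) (fst m)"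

text \<open>
  A nonzero term enters the order on terms only through its valuation and its monomial, so it is
  represented by this pair. \<open>after k\<close> consists of the terms strictly larger than \<open>k\<close>; note that a
  smaller monomial makes a term larger.
\<close>

definition after :: "ereal \<times> 'n expo \<times> 'd::linorder \<Rightarrow> (ereal \<times> 'n expo \<times> 'd) set" where
  "after k = {k'. fst k < fst k' \<or> fst k = fst k' \<and> mon_less lt (snd k') (snd k)}"

text \<open>
  Lower bounds on initial terms, strict and weak, are both of the form "all terms lie in \<open>U\<close>" for an
  up-closed set \<open>U\<close> of terms; the empty set is the bound given by the initial term of 0. The
  closure properties are proved once for all such \<open>U\<close>.
\<close>

definition up_closed :: "(ereal \<times> 'n expo \<times> 'd::linorder) set \<Rightarrow> bool" where
  "up_closed U \<longleftrightarrow> (\<forall>k\<in>U. after k \<subseteq> U)"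

definition terms_in :: "(ereal \<times> 'n expo \<times> 'd) set \<Rightarrow> ('n, 'k, 'd::{finite,linorder}) pmod \<Rightarrow> bool" where
  "terms_in U x \<longleftrightarrow> (\<forall>m\<in>supp x. (tv x m, m) \<in> U)"

definition lm :: "('n, 'k, 'd::{finite,linorder}) pmod \<Rightarrow> 'n expo \<times> 'd" where
  "lm x = initial_monomial v w lt x"

definition key :: "('n, 'k, 'd::{finite,linorder}) pmod \<Rightarrow> ereal \<times> 'n expo \<times> 'd" where
  "key x = (tv x (lm x), lm x)"

lemma not_after_self: "k \<notin> after k"
  by (simp add: after_def mon_less_irrefl)

lemma after_trans: "k' \<in> after k \<Longrightarrow> k'' \<in> after k' \<Longrightarrow> k'' \<in> after k"
  using mon_less_trans[of "snd k''" "snd k'" "snd k"] by (auto simp: after_def)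

lemma up_closed_after: "up_closed (after k)"
  unfolding up_closed_def using after_trans by blast

lemma up_closed_insert_after: "up_closed (insert k (after k))"
  unfolding up_closed_def using after_trans by blast

lemma up_closed_mono:
  assumes "up_closed U" and "(V, m) \<in> U" and "V \<le> V'"
  shows "(V', m) \<in> U"
proof (cases "V = V'")
  case False
  with assms(3) have "(V', m) \<in> after (V, m)" by (simp add: after_def)
  with assms(1,2) show ?thesis by (auto simp: up_closed_def)
qed (use assms in simp)

lemma tv_eq: "tv x m = v (coefficient x m) + ereal (weight_dot w (fst m))"
  by (simp add: tv_def term_val_def)

lemma tv_infinity: "m \<notin> supp x \<Longrightarrow> tv x m = \<infinity>"
  using v_eq_infinity_iff[of 0] by (simp add: supp_def tv_eq)

lemma terms_in_zero [simp]: "terms_in U 0"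
  by (simp add: terms_in_def)

text \<open>
  The valuation of a difference is at least one of the two valuations. Where that one belongs to an
  absent term, it is infinite, and the term of the other element serves as a lower bound instead.
\<close>

lemma terms_in_diff:
  assumes U: "up_closed U" and x: "terms_in U x" and y: "terms_in U y"
  shows "terms_in U (x - y)"
  unfolding terms_in_def
proof
  fix m assume "m \<in> supp (x - y)"
  then have m: "m \<in> supp x \<union> supp y" using supp_diff_subset by blast
  have "v (coefficient x m) \<le> v (coefficient (x - y) m) \<or> v (coefficient y m) \<le> v (coefficient (x - y) m)"
    using v_diff[of "coefficient x m" "coefficient y m"] by (simp only: coefficient_diff min_le_iff_disj)
  then consider "tv x m \<le> tv (x - y) m" | "tv y m \<le> tv (x - y) m"
    unfolding tv_eq using add_right_mono by blast
  then show "(tv (x - y) m, m) \<in> U"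
  proof cases
    case 1
    show ?thesis
    proof (cases "m \<in> supp x")
      case True
      with x have "(tv x m, m) \<in> U" by (auto simp: terms_in_def)
      then show ?thesis using 1 by (rule up_closed_mono[OF U])
    next
      case False
      with m y have "(tv y m, m) \<in> U" by (auto simp: terms_in_def)
      moreover have "tv x m = \<infinity>" using False by (rule tv_infinity)
      ultimately show ?thesis using 1 up_closed_mono[OF U] by simp
    qed
  next
    case 2
    show ?thesis
    proof (cases "m \<in> supp y")
      case True
      with y have "(tv y m, m) \<in> U" by (auto simp: terms_in_def)
      then show ?thesis using 2 by (rule up_closed_mono[OF U])
    next
      case False
      with m x have "(tv x m, m) \<in> U" by (auto simp: terms_in_def)
      moreover have "tv y m = \<infinity>" using False by (rule tv_infinity)
      ultimately show ?thesis using 2 up_closed_mono[OF U] by simp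
    qed
  qed
qed

lemma terms_in_uminus: "terms_in U x \<Longrightarrow> terms_in U (- x)"
  by (simp add: terms_in_def supp_def tv_eq coefficient_def v_uminus)

lemma terms_in_add:
  assumes "up_closed U" and "terms_in U x" and "terms_in U y"
  shows "terms_in U (x + y)"
  using terms_in_diff[OF assms(1,2) terms_in_uminus[OF assms(3)]] by simp

lemma terms_in_smult_scalar:
  assumes U: "up_closed U" and a: "0 \<le> v a" and x: "terms_in U x"
  shows "terms_in U (Poly_Mapping.single 0 a *s x)"
  unfolding terms_in_def
proof
  fix m assume "m \<in> supp (Poly_Mapping.single 0 a *s x)"
  then have "(tv x m, m) \<in> U"
    using x supp_smult_scalar_subset by (auto simp: terms_in_def)
  moreover have "tv x m \<le> tv (Poly_Mapping.single 0 a *s x) m"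
    using add_mono[OF a order_refl, of "tv x m"]
    by (simp add: tv_eq coefficient_smult_scalar v_mult add.assoc)
  ultimately show "(tv (Poly_Mapping.single 0 a *s x) m, m) \<in> U"
    by (rule up_closed_mono[OF U])
qed

text \<open>
  The description of the initial monomial in its definition determines it: the monomials
  of minimal value form a nonempty finite set, totally ordered by the monomial order.
\<close>

lemma
  assumes "x \<noteq> 0"
  shows lm_in_supp: "lm x \<in> supp x"
    and terms_after_lm: "m \<in> supp x \<Longrightarrow> m \<noteq> lm x \<Longrightarrow> (tv x m, m) \<in> after (key x)"
proof -
  define M where "M = {m \<in> supp x. tv x m = min_val v w x}"
  have ne: "supp x \<noteq> {}" using assms by (simp add: supp_eq_empty_iff)
  have mv: "min_val v w x = Min (tv x ` supp x)"
    by (simp add: min_val_def tv_def [abs_def])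
  have "min_val v w x \<in> tv x ` supp x"
    unfolding mv using ne finite_supp by (intro Min_in) auto
  then obtain m\<^sub>0 where "m\<^sub>0 \<in> supp x" and "tv x m\<^sub>0 = min_val v w x" by (metis imageE)
  then have "M \<noteq> {}" unfolding M_def by blast
  moreover have "finite M" by (simp add: M_def finite_supp)
  moreover have "transp_on M (mon_less lt)"
    by (rule transp_onI) (rule mon_less_trans)
  moreover have "totalp_on M (mon_less lt)"
    by (rule totalp_onI) (rule mon_less_total)
  ultimately obtain m\<^sub>1 where m\<^sub>1: "m\<^sub>1 \<in> M" "\<forall>m'\<in>M. m' \<noteq> m\<^sub>1 \<longrightarrow> mon_less lt m' m\<^sub>1"
    using Finite_Set.bex_greatest_element[of M "mon_less lt"] by blast
  have "lm x = m\<^sub>1"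
    unfolding lm_def initial_monomial_def Let_def M_def[unfolded tv_def, symmetric]
  proof (rule the_equality)
    fix m assume m: "m \<in> M \<and> (\<forall>m'\<in>M. m' \<noteq> m \<longrightarrow> mon_less lt m' m)"
    show "m = m\<^sub>1"
    proof (rule ccontr)
      assume "m \<noteq> m\<^sub>1"
      with m m\<^sub>1 have "mon_less lt m\<^sub>1 m" "mon_less lt m m\<^sub>1" by auto
      then show False using mon_less_trans mon_less_irrefl by blast
    qed
  qed (use m\<^sub>1 in blast)
  have "min_val v w x \<le> tv x m" if "m \<in> supp x" for m
    unfolding mv using that finite_supp by (intro Min_le) auto
  note min_le = this
  show "lm x \<in> supp x"
    using m\<^sub>1 \<open>lm x = m\<^sub>1\<close> by (simp add: M_def)
  show "(tv x m, m) \<in> after (key x)" if "m \<in> supp x" and "m \<noteq> lm x"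
  proof (cases "tv x m = min_val v w x")
    case True
    with that(1) have "m \<in> M" by (simp add: M_def)
    with that(2) m\<^sub>1 \<open>lm x = m\<^sub>1\<close> have "mon_less lt m m\<^sub>1" by blast
    with True m\<^sub>1 \<open>lm x = m\<^sub>1\<close> show ?thesis by (simp add: M_def after_def key_def)
  next
    case False
    with min_le[OF that(1)] m\<^sub>1 \<open>lm x = m\<^sub>1\<close> show ?thesis by (simp add: M_def after_def key_def)
  qed
qed

lemma initial_term_eq:
  "x \<noteq> 0 \<Longrightarrow> initial_term v w lt x = mterm (coefficient x (lm x)) (fst (lm x)) (snd (lm x))"
  by (simp add: initial_term_def lm_def Let_def)

lemma lc_nonzero: "x \<noteq> 0 \<Longrightarrow> coefficient x (lm x) \<noteq> 0"
  using lm_in_supp[of x] by (simp add: supp_def)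

lemma terms_in_insert_key: "x \<noteq> 0 \<Longrightarrow> terms_in (insert (key x) (after (key x))) x"
  using terms_after_lm[of x] by (simp add: terms_in_def key_def) metis

lemma key_in: "terms_in U x \<Longrightarrow> x \<noteq> 0 \<Longrightarrow> key x \<in> U"
  using lm_in_supp by (auto simp: terms_in_def key_def)

lemma terms_in_mono: "terms_in U x \<Longrightarrow> U \<subseteq> U' \<Longrightarrow> terms_in U' x"
  by (auto simp: terms_in_def)

text \<open>
  The second hypothesis covers the convention that 0 is larger than every nonzero term, so that only
  0 has an initial term at least that of 0.
\<close>

lemma term_ge_initial_term:
  assumes "y \<noteq> 0 \<Longrightarrow> terms_in (insert (key y) (after (key y))) x" and "y = 0 \<Longrightarrow> x = 0"
  shows "term_ge v w lt (initial_term v w lt x) (initial_term v w lt y)"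
proof (cases "x = 0")
  case True
  then show ?thesis using mterm_nonzero by (auto simp: term_ge_def term_less_def initial_term_def)
next
  case False
  then have y: "y \<noteq> 0" using assms(2) by auto
  have "key x \<in> insert (key y) (after (key y))"
    using assms(1) y False by (intro key_in)
  then have "key y \<notin> after (key x)"
    using not_after_self after_trans by (metis insert_iff)
  then have nless: "\<not> (tv x (lm x) < tv y (lm y) \<or>
      tv x (lm x) = tv y (lm y) \<and> mon_less lt (lm y) (lm x))"
    by (simp add: after_def key_def)
  show ?thesis
  proof (unfold term_ge_def, rule notI)
    assume "term_less v w lt (initial_term v w lt x) (initial_term v w lt y)"
    then obtain a \<alpha> i b \<beta> j where "a \<noteq> 0" "b \<noteq> 0"
      and x': "initial_term v w lt x = mterm a \<alpha> i" and y': "initial_term v w lt y = mterm b \<beta> j"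
      and less: "term_val v w a \<alpha> < term_val v w b \<beta> \<or>
        term_val v w a \<alpha> = term_val v w b \<beta> \<and> mon_less lt (\<beta>, j) (\<alpha>, i)"
      unfolding term_less_def using y lc_nonzero[OF y] by (auto simp: initial_term_eq mterm_nonzero)
    have "coefficient x (lm x) = a" "lm x = (\<alpha>, i)" "coefficient y (lm y) = b" "lm y = (\<beta>, j)"
      using x' y' False y lc_nonzero[of x] lc_nonzero[of y]
      by (auto simp: initial_term_eq mterm_eq_iff prod_eq_iff)
    then show False using less nless by (simp add: tv_def)
  qed
qed

lemma weight_dot_add: "weight_dot w (u + u') = weight_dot w u + weight_dot w u'"
  by (simp add: weight_dot_def lookup_add sum.distrib distrib_left)

lemma tv_smult_single:
  "tv (Poly_Mapping.single \<gamma> a *s x) (\<gamma> + \<beta>, k) = (v a + ereal (weight_dot w \<gamma>)) + tv x (\<beta>, k)"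
  unfolding tv_eq fst_conv coefficient_smult_single v_mult weight_dot_add plus_ereal.simps(1)[symmetric]
  by (simp only: ac_simps)

lemma terms_in_insertD: "terms_in (insert (V, m) U) x \<Longrightarrow> m \<notin> supp x \<Longrightarrow> terms_in U x"
  by (auto simp: terms_in_def)

lemma supp_initial_term_subset: "supp (initial_term v w lt x) \<subseteq> {lm x}"
proof (cases "x = 0")
  case True
  then show ?thesis by (simp add: initial_term_def)
next
  case False
  then show ?thesis by (auto simp: initial_term_eq supp_def coefficient_mterm)
qed

lemma coefficient_initial_term: "x \<noteq> 0 \<Longrightarrow> coefficient (initial_term v w lt x) (lm x) = coefficient x (lm x)"
  by (simp add: initial_term_eq coefficient_mterm)

lemma terms_in_initial_term:
  assumes "x \<noteq> 0"
  shows "terms_in (insert (key x) (after (key x))) (initial_term v w lt x)"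
  using supp_initial_term_subset[of x] assms
  by (auto simp: terms_in_def key_def tv_eq coefficient_initial_term)

lemma terms_in_minus_initial_term:
  assumes "x \<noteq> 0"
  shows "terms_in (after (key x)) (x - initial_term v w lt x)"
proof (rule terms_in_insertD)
  show "terms_in (insert (tv x (lm x), lm x) (after (key x))) (x - initial_term v w lt x)"
    unfolding key_def[symmetric]
    by (rule terms_in_diff[OF up_closed_insert_after terms_in_insert_key[OF assms] terms_in_initial_term[OF assms]])
  show "lm x \<notin> supp (x - initial_term v w lt x)"
    by (simp add: supp_def coefficient_diff coefficient_initial_term[OF assms])
qed

text \<open>
  The quotient of two initial terms is a single polynomial term, and multiplying by it carries the
  initial term of the divisor to that of the dividend.
\<close>

lemma term_dvd_initial_termE:
  assumes "q \<noteq> 0" and "term_dvd (initial_term v w lt p) (initial_term v w lt q)"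
  obtains \<gamma> a where "p \<noteq> 0" and "a \<noteq> 0"
    and "term_quot (initial_term v w lt q) (initial_term v w lt p) = Poly_Mapping.single \<gamma> a"
    and "lm q = (\<gamma> + fst (lm p), snd (lm p))"
    and "coefficient q (lm q) = a * coefficient p (lm p)"
proof -
  have "p \<noteq> 0" using assms(2) by (auto simp: initial_term_def)
  note lc = lc_nonzero[OF this] lc_nonzero[OF assms(1)]
  from assms \<open>p \<noteq> 0\<close> lc obtain \<gamma> where \<gamma>: "snd (lm q) = snd (lm p)" "fst (lm q) = \<gamma> + fst (lm p)"
    by (auto simp: initial_term_eq term_dvd_mterm_iff)
  show thesis
  proof (rule that)
    show "term_quot (initial_term v w lt q) (initial_term v w lt p)
        = Poly_Mapping.single \<gamma> (coefficient q (lm q) / coefficient p (lm p))"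
      using assms(1) \<open>p \<noteq> 0\<close> lc \<gamma> by (simp add: initial_term_eq term_quot_mterm)
  qed (use \<open>p \<noteq> 0\<close> lc \<gamma> in \<open>simp_all add: prod_eq_iff\<close>)
qed

text \<open>
  Multiplication by a term adds a constant to all values and is compatible with the monomial order,
  so it preserves the order of the terms. The multiple of the divisor hence starts with the initial
  term of \<open>q\<close>, which cancels in the difference: one reduction strictly increases the
  initial term.
\<close>

lemma terms_in_multiple:
  assumes "p \<noteq> 0" and "a \<noteq> 0" and "lm q = (\<gamma> + fst (lm p), snd (lm p))"
    and "coefficient q (lm q) = a * coefficient p (lm p)"
  shows "terms_in (insert (key q) (after (key q))) (Poly_Mapping.single \<gamma> a *s p)" (is "terms_in ?U ?x")
    and "terms_in (after (key q)) (q - Poly_Mapping.single \<gamma> a *s p)"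
    and "lm q \<notin> supp (q - Poly_Mapping.single \<gamma> a *s p)"
proof -
  have coeff: "coefficient ?x (lm q) = coefficient q (lm q)"
    using coefficient_smult_single[of \<gamma> a p "fst (lm p)" "snd (lm p)"] assms by simp
  then have q: "q \<noteq> 0"
    using assms lc_nonzero[of p] by (auto simp: coefficient_def)
  have key: "key q = (tv ?x (lm q), lm q)"
    by (simp add: key_def tv_eq coeff)
  obtain \<rho> where \<rho>: "v a = ereal \<rho>" using assms(2) by (rule v_nonzeroE)
  show U: "terms_in ?U ?x"
    unfolding terms_in_def
  proof
    fix m assume "m \<in> supp ?x"
    then obtain \<beta> k where m: "m = (\<gamma> + \<beta>, k)" and mp: "(\<beta>, k) \<in> supp p"
      by (rule supp_smult_singleE)
    show "(tv ?x m, m) \<in> ?U"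
    proof (cases "(\<beta>, k) = lm p")
      case True
      with m assms(3) have "m = lm q" by (metis fst_conv snd_conv)
      then show ?thesis by (simp add: key)
    next
      case False
      then have "(tv p (\<beta>, k), (\<beta>, k)) \<in> after (key p)"
        using terms_after_lm[OF assms(1) mp] by simp
      then have less: "tv p (lm p) < tv p (\<beta>, k) \<or> tv p (lm p) = tv p (\<beta>, k) \<and> mon_less lt (\<beta>, k) (lm p)"
        by (simp add: after_def key_def)
      let ?c = "v a + ereal (weight_dot w \<gamma>)"
      have tvs: "tv ?x m = ?c + tv p (\<beta>, k)" "tv ?x (lm q) = ?c + tv p (lm p)"
        using tv_smult_single[of \<gamma> a p "fst (lm p)" "snd (lm p)"] by (simp_all add: m tv_smult_single assms(3))
      have c: "?c = ereal (\<rho> + weight_dot w \<gamma>)" by (simp add: \<rho>)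
      from less show ?thesis
      proof
        assume "tv p (lm p) < tv p (\<beta>, k)"
        then have "tv ?x (lm q) < tv ?x m"
          unfolding tvs c by (simp add: ereal_less_add)
        then show ?thesis by (simp add: key after_def)
      next
        assume *: "tv p (lm p) = tv p (\<beta>, k) \<and> mon_less lt (\<beta>, k) (lm p)"
        then have "mon_less lt (\<beta>, k) (fst (lm p), snd (lm p))" by simp
        then have "mon_less lt m (lm q)" unfolding m assms(3) by (rule mon_less_shift)
        with * show ?thesis by (simp add: key after_def tvs)
      qed
    qed
  qed
  show notin: "lm q \<notin> supp (q - ?x)"
    by (simp add: supp_def coefficient_diff coeff)
  show "terms_in (after (key q)) (q - ?x)"
  proof (rule terms_in_insertD)
    show "terms_in (insert (tv q (lm q), lm q) (after (key q))) (q - ?x)"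
      unfolding key_def[symmetric]
      by (rule terms_in_diff[OF up_closed_insert_after terms_in_insert_key[OF q] U])
  qed (rule notin)
qed

end

section \<open>The invariant of the division algorithm\<close>

locale homogeneous_division = valued_monomial_order v w lt
  for v :: "'k::field \<Rightarrow> ereal" and w :: "real ^ 'n::finite" and lt :: "'n expo \<Rightarrow> 'n expo \<Rightarrow> bool" +
  fixes f :: "('n, 'k, 'd::{finite, linorder}) pmod"
    and g :: "nat \<Rightarrow> ('n, 'k, 'd) pmod"
    and s :: nat
    and e :: nat
  assumes degree_f: "m \<in> supp f \<Longrightarrow> total_degree (fst m) = e"
    and homogeneous_g: "k \<in> {1..s} \<Longrightarrow> homogeneous (g k)"
begin

text \<open>The terms that are at least the initial term of \<open>f\<close>, in the convention that no nonzero term is at least 0.\<close>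

definition admissible :: "(ereal \<times> 'n expo \<times> 'd) set" where
  "admissible = (if f = 0 then {} else insert (key f) (after (key f)))"

definition monomials_e :: "('n expo \<times> 'd) set" where
  "monomials_e = {m. total_degree (fst m) = e}"

definition irreducibles :: "('n expo \<times> 'd) set" where
  "irreducibles = {m. \<forall>i\<in>{1..s}. \<not> term_dvd (initial_term v w lt (g i)) (mterm 1 (fst m) (snd m))}"

text \<open>
  With \<open>q = 0\<close> this yields the correctness claim for the output. It is required of the current values and of
  every stored triple, since an iteration may combine the two.
\<close>

definition sound :: "('n, 'k, 'd) pmod \<Rightarrow> (nat \<Rightarrow> ('n, 'k) mpoly) \<Rightarrow> ('n, 'k, 'd) pmod \<Rightarrow> bool" where
  "sound q h r \<longleftrightarrow>
     f = q + (\<Sum>i=1..s. h i *s g i) + r \<and>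
     supp q \<subseteq> monomials_e \<and> terms_in admissible q \<and>
     (\<forall>i\<in>{1..s}. terms_in admissible (h i *s g i)) \<and>
     supp r \<subseteq> irreducibles \<and> terms_in admissible r"

text \<open>
  The first conjunct is an equation for the parameter \<open>f\<close>, on which \<open>admissible\<close> depends as well. As a
  rewrite rule it would unfold \<open>f\<close> inside \<open>admissible\<close>; these rules give access to the conjuncts one by
  one.
\<close>

lemma soundI:
  assumes "f = q + (\<Sum>i=1..s. h i *s g i) + r" and "supp q \<subseteq> monomials_e" and "terms_in admissible q"
    and "\<And>i. i \<in> {1..s} \<Longrightarrow> terms_in admissible (h i *s g i)"
    and "supp r \<subseteq> irreducibles" and "terms_in admissible r"
  shows "sound q h r"
  unfolding sound_def using assms by blast

lemma soundD:
  assumes "sound q h r"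
  shows "f = q + (\<Sum>i=1..s. h i *s g i) + r" and "supp q \<subseteq> monomials_e" and "terms_in admissible q"
    and "i \<in> {1..s} \<Longrightarrow> terms_in admissible (h i *s g i)"
    and "supp r \<subseteq> irreducibles" and "terms_in admissible r"
  using assms unfolding sound_def by blast+

lemma up_closed_admissible: "up_closed admissible"
proof (cases "f = 0")
  case True
  then have "admissible = {}" unfolding admissible_def by (rule if_P)
  then show ?thesis by (simp add: up_closed_def)
next
  case False
  then show ?thesis by (simp add: admissible_def up_closed_insert_after)
qed

lemma insert_after_subset_admissible:
  assumes "terms_in admissible q" and "q \<noteq> 0"
  shows "insert (key q) (after (key q)) \<subseteq> admissible"
  using key_in[OF assms] up_closed_admissible by (auto simp: up_closed_def)

lemma sound_initial: "sound f (\<lambda>k. 0) 0"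
proof -
  have "terms_in admissible f"
    by (cases "f = 0") (simp_all add: admissible_def terms_in_insert_key)
  moreover have "supp f \<subseteq> monomials_e" using degree_f by (auto simp: monomials_e_def)
  ultimately show ?thesis by (simp add: sound_def)
qed

lemma sound_remainder_step:
  assumes sound: "sound q h r" and q: "q \<noteq> 0"
    and irred: "\<And>i. i \<in> {1..s} \<Longrightarrow> \<not> term_dvd (initial_term v w lt (g i)) (initial_term v w lt q)"
  shows "sound (q - initial_term v w lt q) h (r + initial_term v w lt q)"
proof -
  let ?t = "initial_term v w lt q"
  have U: "insert (key q) (after (key q)) \<subseteq> admissible"
    using soundD(3)[OF sound] q by (rule insert_after_subset_admissible)
  then have t: "terms_in admissible ?t"
    using terms_in_initial_term[OF q] terms_in_mono by blast
  have "lm q \<in> irreducibles"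
    unfolding irreducibles_def
  proof safe
    fix i assume i: "i \<in> {1..s}" and dvd: "term_dvd (initial_term v w lt (g i)) (mterm 1 (fst (lm q)) (snd (lm q)))"
    then have "g i \<noteq> 0" by (auto simp: initial_term_def)
    with dvd irred[OF i] q lc_nonzero[of q] lc_nonzero[of "g i"] show False
      by (simp add: initial_term_eq term_dvd_mterm_iff)
  qed
  then have "supp ?t \<subseteq> irreducibles" using supp_initial_term_subset[of q] by auto
  moreover have "supp ?t \<subseteq> supp q"
    using supp_initial_term_subset[of q] lm_in_supp[OF q] by auto
  ultimately show ?thesis
    using supp_diff_subset[of q ?t] supp_add_subset[of r ?t] soundD(1,2,5)[OF sound]
    by (intro soundI terms_in_diff terms_in_add up_closed_admissible t soundD(3,4,6)[OF sound])
      (blast | simp add: add.assoc)+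
qed

text \<open>
  The multiple of \<open>g k\<close> is homogeneous and contains the initial monomial of \<open>q\<close>, so it has degree \<open>e\<close>. Its
  first term is the initial term of \<open>q\<close>, so it respects the same lower bound.
\<close>

lemma sound_input_step:
  assumes sound: "sound q h r" and q: "q \<noteq> 0" and k: "k \<in> {1..s}"
    and dvd: "term_dvd (initial_term v w lt (g k)) (initial_term v w lt q)"
    and c: "c = term_quot (initial_term v w lt q) (initial_term v w lt (g k))"
  shows "sound (q - c *s g k) (h(k := h k + c)) r"
proof -
  from q dvd obtain \<gamma> a where gk: "g k \<noteq> 0" "a \<noteq> 0"
      and quot: "term_quot (initial_term v w lt q) (initial_term v w lt (g k)) = Poly_Mapping.single \<gamma> a"
      and lm: "lm q = (\<gamma> + fst (lm (g k)), snd (lm (g k)))"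
      and lc: "coefficient q (lm q) = a * coefficient (g k) (lm (g k))"
    by (rule term_dvd_initial_termE)
  have U: "insert (key q) (after (key q)) \<subseteq> admissible"
    using soundD(3)[OF sound] q by (rule insert_after_subset_admissible)
  then have t: "terms_in admissible (c *s g k)"
    unfolding c quot using terms_in_multiple(1)[OF gk lm lc] terms_in_mono by blast
  have "supp (c *s g k) \<subseteq> monomials_e"
  proof
    fix m assume "m \<in> supp (c *s g k)"
    then obtain \<beta> j where m: "m = (\<gamma> + \<beta>, j)" "(\<beta>, j) \<in> supp (g k)"
      unfolding c quot by (rule supp_smult_singleE)
    have "lm q \<in> monomials_e" using soundD(2)[OF sound] lm_in_supp[OF q] by blast
    moreover have "total_degree \<beta> = total_degree (fst (lm (g k)))"
      using homogeneous_g[OF k] m(2) lm_in_supp[OF gk(1)] unfolding homogeneous_def by (metis fst_conv)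
    ultimately show "m \<in> monomials_e" by (simp add: monomials_e_def m lm total_degree_add)
  qed
  then have supp: "supp (q - c *s g k) \<subseteq> monomials_e"
    using supp_diff_subset[of q "c *s g k"] soundD(2)[OF sound] by blast
  have h: "(h(k := h k + c)) i *s g i = h i *s g i + (if i = k then c *s g k else 0)" for i
    by (simp add: vector_sadd_rdistrib)
  have "(\<Sum>i=1..s. (h(k := h k + c)) i *s g i) = (\<Sum>i=1..s. h i *s g i) + c *s g k"
    unfolding h using k by (simp add: sum.distrib)
  then have "f = (q - c *s g k) + (\<Sum>i=1..s. (h(k := h k + c)) i *s g i) + r"
    using soundD(1)[OF sound] by (simp only: add.assoc diff_add_eq) (simp add: algebra_simps)
  moreover have "terms_in admissible ((h(k := h k + c)) i *s g i)" if "i \<in> {1..s}" for i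
    unfolding h using t soundD(4)[OF sound that] by (simp add: terms_in_add up_closed_admissible)
  ultimately show ?thesis
    by (intro soundI supp terms_in_diff up_closed_admissible t soundD[OF sound])
qed

text \<open>
  Two decompositions of the same \<open>f\<close> combine to another one when the coefficients add up to 1. Nonnegative
  valuation of the coefficients preserves the lower bounds on terms, and scalars create no new
  monomials.
\<close>

lemma sound_affine_combination:
  assumes sound: "sound q h r" "sound q' h' r'" and val: "0 \<le> v b" "0 \<le> v b'" and one: "b + b' = 1"
  defines "B \<equiv> Poly_Mapping.single 0 b" and "B' \<equiv> Poly_Mapping.single 0 b'"
  shows "sound (B *s q + B' *s q') (\<lambda>k. B * h k + B' * h' k) (B *s r + B' *s r')"
proof -
  let ?S = "\<lambda>h. \<Sum>i=1..s. h i *s g i"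
  have one': "B + B' = 1"
    unfolding B_def B'_def by (simp add: one flip: single_add)
  have hi: "(B * h i + B' * h' i) *s g i = B *s (h i *s g i) + B' *s (h' i *s g i)" for i
    by (simp add: vector_sadd_rdistrib vector_smult_assoc)
  have f: "f = q + ?S h + r" "f = q' + ?S h' + r'"
    using sound[THEN soundD(1)] .
  have "f = B *s f + B' *s f" by (simp add: one' flip: vector_sadd_rdistrib)
  also have "\<dots> = B *s (q + ?S h + r) + B' *s (q' + ?S h' + r')"
    by (intro arg_cong2[where f = "(+)"] arg_cong[where f = "(*s) _"] f)
  also have "\<dots> = (B *s q + B' *s q') + (B *s ?S h + B' *s ?S h') + (B *s r + B' *s r')"
    by (simp add: vector_add_ldistrib algebra_simps)
  also have "B *s ?S h + B' *s ?S h' = (\<Sum>i=1..s. (B * h i + B' * h' i) *s g i)"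
    by (simp add: hi sum.distrib sum_cmul)
  finally have decomposition: "f = (B *s q + B' *s q') + (\<Sum>i=1..s. (B * h i + B' * h' i) *s g i) + (B *s r + B' *s r')" .
  have supp: "supp (B *s x + B' *s x') \<subseteq> A" if "supp x \<subseteq> A" "supp x' \<subseteq> A" for x x' A
    using that supp_add_subset[of "B *s x" "B' *s x'"]
      supp_smult_scalar_subset[of b x] supp_smult_scalar_subset[of b' x']
    unfolding B_def B'_def by blast
  have terms: "terms_in admissible (B *s x + B' *s x')" if "terms_in admissible x" "terms_in admissible x'" for x x'
    unfolding B_def B'_def
    by (intro terms_in_add terms_in_smult_scalar up_closed_admissible val that)
  show ?thesis
  proof (rule soundI[OF decomposition])
    show "terms_in admissible ((B * h i + B' * h' i) *s g i)" if "i \<in> {1..s}" for i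
      unfolding hi using that by (intro terms sound[THEN soundD(4)])
  qed (intro supp terms sound[THEN soundD(2)] sound[THEN soundD(3)] sound[THEN soundD(5)] sound[THEN soundD(6)])+
qed

text \<open>Terms of the same degree can only divide each other with a quotient of degree 0.\<close>

lemma scalar_quotientE:
  assumes q: "q \<noteq> 0" and dvd: "term_dvd (initial_term v w lt p) (initial_term v w lt q)"
    and deg: "lm q \<in> monomials_e" "lm p \<in> monomials_e"
  obtains a where "p \<noteq> 0" and "a \<noteq> 0"
    and "term_quot (initial_term v w lt q) (initial_term v w lt p) = Poly_Mapping.single 0 a"
    and "lm q = lm p"
    and "coefficient q (lm q) = a * coefficient p (lm p)"
proof -
  from q dvd obtain \<gamma> a where *: "p \<noteq> 0" "a \<noteq> 0"
      "term_quot (initial_term v w lt q) (initial_term v w lt p) = Poly_Mapping.single \<gamma> a"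
      "lm q = (\<gamma> + fst (lm p), snd (lm p))"
      "coefficient q (lm q) = a * coefficient p (lm p)"
    by (rule term_dvd_initial_termE)
  have "\<gamma> = 0"
    using deg by (simp add: monomials_e_def *(4) total_degree_add total_degree_eq_0_iff)
  with * have "lm q = lm p" by simp
  with * \<open>\<gamma> = 0\<close> show thesis by (intro that[of a]) simp_all
qed

lemma v_quotient_pos:
  assumes "q \<noteq> 0" and "p \<noteq> 0" and "a \<noteq> 0" and later: "terms_in (after (key p)) q"
    and lm: "lm q = lm p" and lc: "coefficient q (lm q) = a * coefficient p (lm p)"
  shows "0 < v a"
proof -
  obtain \<alpha> where \<alpha>: "v a = ereal \<alpha>" using \<open>a \<noteq> 0\<close> by (rule v_nonzeroE)
  obtain \<beta> where \<beta>: "v (coefficient p (lm p)) = ereal \<beta>" using lc_nonzero[OF \<open>p \<noteq> 0\<close>] by (rule v_nonzeroE)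
  have "key q \<in> after (key p)" using later \<open>q \<noteq> 0\<close> by (rule key_in)
  then have "tv p (lm p) < tv q (lm q)"
    by (simp add: after_def key_def lm mon_less_irrefl)
  then show ?thesis
    using lc unfolding lm by (simp add: tv_eq v_mult \<alpha> \<beta>)
qed

text \<open>
  The new values are $b x + b' x'$ with $b = 1/(1 - a)$ and $b' = -a/(1 - a)$, where \<open>x\<close> is the current
  value and \<open>x'\<close> the stored one; $b + b' = 1$ and both have nonnegative valuation because
  $v(1 - a) = 0$.
\<close>

lemma sound_earlier_step:
  assumes sound: "sound q h r" "sound p h' r'" and pos: "0 < v a"
    and c: "c = Poly_Mapping.single 0 a" and inverse: "E * (1 - c) = 1"
  shows "sound (E *s (q - c *s p)) (\<lambda>k. E * (h k - c * h' k)) (E *s (r - c *s r'))"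
    and "E = Poly_Mapping.single 0 (inverse (1 - a))"
proof -
  define b where "b = inverse (1 - a)"
  have vb: "v b = 0" unfolding b_def using pos by (intro v_inverse v_one_minus)
  have "1 - a \<noteq> 0"
    using v_one_minus[OF pos] v_eq_infinity_iff[of "1 - a"] by auto
  then have b: "(1 - a) * b = 1" by (simp add: b_def)
  have "1 - c = Poly_Mapping.single 0 (1 - a)" by (simp add: c single_diff)
  then have "(1 - c) * Poly_Mapping.single 0 b = 1" by (simp add: mult_single b)
  then have E: "E = Poly_Mapping.single 0 b"
    by (metis inverse mult.assoc[of E "1 - c"] mult_1 mult_1_right)
  then show "E = Poly_Mapping.single 0 (inverse (1 - a))" by (simp add: b_def)
  have neg: "- (E * c) = Poly_Mapping.single 0 (- (b * a))"
    by (simp add: E c mult_single single_uminus)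
  have "sound (E *s q + - (E * c) *s p) (\<lambda>k. E * h k + - (E * c) * h' k) (E *s r + - (E * c) *s r')"
    unfolding neg unfolding E
  proof (rule sound_affine_combination[OF sound])
    show "b + - (b * a) = 1" using b by (simp add: algebra_simps)
    show "0 \<le> v b" "0 \<le> v (- (b * a))" using pos vb by (simp_all add: v_uminus v_mult)
  qed
  moreover have "E *s x + - (E * c) *s y = E *s (x - c *s y)" for x y :: "('n, 'k, 'd) pmod"
    by (simp add: vector_ssub_ldistrib vector_smult_assoc vector_smult_lneg)
  moreover have "E * x + - (E * c) * y = E * (x - c * y)" for x y
    by (simp add: algebra_simps)
  ultimately show "sound (E *s (q - c *s p)) (\<lambda>k. E * (h k - c * h' k)) (E *s (r - c *s r'))"
    by simp
qed

text \<open>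
  The initial term of \<open>q\<close> lies beyond that of every stored dividend; this is what makes the
  quotient by an earlier dividend a scalar of positive valuation, and it excludes \<open>Undefined\<close>.
\<close>

primrec invariant :: "(('n, 'k, 'd) pmod, ('n, 'k) mpoly) config \<Rightarrow> bool" where
  "invariant (Run D M h q r) \<longleftrightarrow>
     D = g ` {1..s} \<union> fst ` M \<and> sound q h r \<and>
     (\<forall>(p, h', r')\<in>M. p \<noteq> 0 \<and> sound p h' r' \<and> terms_in (after (key p)) q)"
| "invariant Undefined \<longleftrightarrow> False"

lemma invariant_initial: "invariant (initial_config g s f)"
  by (simp add: initial_config_def sound_initial)

lemma earlier_divisorE:
  assumes inv: "invariant (Run D M h q r)" and q: "q \<noteq> 0" and pM: "(p, h', r') \<in> M"
    and dvd: "term_dvd (initial_term v w lt p) (initial_term v w lt q)"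
  obtains a where "p \<noteq> 0" and "sound p h' r'" and "a \<noteq> 0" and "0 < v a"
    and "term_quot (initial_term v w lt q) (initial_term v w lt p) = Poly_Mapping.single 0 a"
    and "lm q = lm p" and "coefficient q (lm q) = a * coefficient p (lm p)"
proof -
  have p: "p \<noteq> 0" "sound p h' r'" "terms_in (after (key p)) q" and sq: "sound q h r"
    using inv pM by auto
  have "lm q \<in> monomials_e" "lm p \<in> monomials_e"
    using lm_in_supp[OF p(1)] lm_in_supp[OF q] soundD(2)[OF p(2)] soundD(2)[OF sq] by blast+
  with q dvd obtain a where a: "a \<noteq> 0"
      "term_quot (initial_term v w lt q) (initial_term v w lt p) = Poly_Mapping.single 0 a"
      "lm q = lm p" "coefficient q (lm q) = a * coefficient p (lm p)"
    by (rule scalar_quotientE)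
  have "0 < v a" using q p(1) a(1) p(3) a(3,4) by (rule v_quotient_pos)
  with p a show thesis by (intro that)
qed

lemma invariant_advance:
  assumes inv: "invariant (Run D M h q r)" and q: "q \<noteq> 0"
    and sound: "sound q' h' r'" and later: "terms_in (after (key q)) q'"
  shows "invariant (Run D M h' q' r')"
    and "invariant (Run (insert q D) (insert (q, h, r) M) h' q' r')"
proof -
  have "terms_in (after (key p)) q'" if "(p, h'', r'') \<in> M" for p h'' r''
  proof -
    have "terms_in (after (key p)) q" using inv that by auto
    then have "key q \<in> after (key p)" using q by (rule key_in)
    then have "after (key q) \<subseteq> after (key p)" using after_trans by blast
    with later show ?thesis by (rule terms_in_mono)
  qed
  then show "invariant (Run D M h' q' r')" "invariant (Run (insert q D) (insert (q, h, r) M) h' q' r')"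
    using inv q sound later by auto
qed

section \<open>Termination\<close>

definition signature :: "('n, 'k, 'd) pmod \<Rightarrow> ('n expo \<times> 'd) \<times> ('n expo \<times> 'd) set" where
  "signature q = (lm q, supp q)"

definition signatures :: "(('n expo \<times> 'd) \<times> ('n expo \<times> 'd) set) set" where
  "signatures = monomials_e \<times> Pow monomials_e"

primrec rank :: "(('n, 'k, 'd) pmod, ('n, 'k) mpoly) config \<Rightarrow> nat \<times> nat" where
  "rank (Run D M h q r) = (card (signatures - signature ` fst ` M), card (supp q))"
| "rank Undefined = (0, 0)"

text \<open>
  A stored element \<open>p\<close> with the signature of \<open>q\<close> has the same initial monomial, hence an initial term
  dividing that of \<open>q\<close>, and the same support, hence ecart 0. The premise \<open>minimal\<close> rules this out.
\<close>

lemma rank_record: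
  assumes inv: "invariant (Run D M h q r)" and q: "q \<noteq> 0"
    and minimal: "\<And>p. p \<in> D \<Longrightarrow> term_dvd (initial_term v w lt p) (initial_term v w lt q) \<Longrightarrow> 0 < ecart q p"
  shows "(rank (Run D' (insert (q, h, r) M) h' q' r'), rank (Run D M h q r)) \<in> less_than <*lex*> less_than"
proof -
  have "supp q \<subseteq> monomials_e" using inv soundD(2)[of q h r] by simp
  then have "signature q \<in> signatures"
    using lm_in_supp[OF q] by (auto simp: signature_def signatures_def)
  moreover have "signature q \<notin> signature ` fst ` M"
  proof
    assume "signature q \<in> signature ` fst ` M"
    then obtain p h\<^sub>p r\<^sub>p where p: "(p, h\<^sub>p, r\<^sub>p) \<in> M" and sig: "signature q = signature p" by auto
    from p inv have "p \<in> D" "p \<noteq> 0" by force+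
    moreover from sig have "lm p = lm q" "supp p = supp q" by (simp_all add: signature_def)
    moreover from this have "term_dvd (initial_term v w lt p) (initial_term v w lt q)"
      using q \<open>p \<noteq> 0\<close> lc_nonzero[of p] lc_nonzero[of q]
      by (auto simp: initial_term_eq term_dvd_mterm_iff intro: exI[of _ 0])
    ultimately show False using minimal[of p] by (simp add: ecart_def)
  qed
  moreover have "finite signatures"
    by (simp add: signatures_def monomials_e_def finite_monomials_of_degree)
  ultimately have "card (signatures - signature ` fst ` insert (q, h, r) M) < card (signatures - signature ` fst ` M)"
    by (intro psubset_card_mono) auto
  then show ?thesis by simp
qed

lemma rank_shrink:
  assumes "supp q' \<subset> supp q"
  shows "(rank (Run D' M h' q' r'), rank (Run D M h q r)) \<in> less_than <*lex*> less_than"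
  using psubset_card_mono[OF finite_supp assms] by simp

text \<open>
  Ecart 0 places the support of the divisor inside that of \<open>q\<close>, hence in the same degree. This is what turns
  the quotient into a scalar even for an input \<open>g k\<close>, whose degree may otherwise be smaller
  than that of \<open>f\<close>.
\<close>

lemma supp_shrinks:
  assumes q: "q \<noteq> 0" and deg: "supp q \<subseteq> monomials_e"
    and dvd: "term_dvd (initial_term v w lt p) (initial_term v w lt q)" and ecart: "ecart q p = 0"
    and c: "c = term_quot (initial_term v w lt q) (initial_term v w lt p)"
  shows "supp (q - c *s p) \<subset> supp q"
proof -
  have "p \<noteq> 0" using dvd by (auto simp: initial_term_def)
  have pq: "supp p \<subseteq> supp q" using ecart by (simp add: ecart_def finite_supp)
  with deg lm_in_supp[OF q] lm_in_supp[OF \<open>p \<noteq> 0\<close>] have "lm q \<in> monomials_e" "lm p \<in> monomials_e" by auto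
  with q dvd obtain a where a: "a \<noteq> 0" and ca: "c = Poly_Mapping.single 0 a" and lm: "lm q = lm p"
    and lc: "coefficient q (lm q) = a * coefficient p (lm p)"
    unfolding c by (rule scalar_quotientE)
  have "lm q \<notin> supp (q - c *s p)"
    unfolding ca using \<open>p \<noteq> 0\<close> a lc lm by (intro terms_in_multiple(3)) simp_all
  moreover have "supp (q - c *s p) \<subseteq> supp q"
    using supp_diff_subset[of q "c *s p"] supp_smult_scalar_subset[of a p] pq unfolding ca by blast
  ultimately show ?thesis using lm_in_supp[OF q] by blast
qed

text \<open>
  The part common to division by an input and by an earlier dividend: a positive minimal
  ecart stores \<open>q\<close> and uses up a signature, and ecart 0 shrinks the support.
\<close>

lemma division_step:
  assumes inv: "invariant (Run D M h q r)" and q: "q \<noteq> 0" and chosen: "chosen_divisor v w lt D q p"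
    and sound: "sound q' h' r'" and later: "terms_in (after (key q)) q'"
    and shrink: "ecart q p = 0 \<Longrightarrow> supp q' \<subset> supp q"
    and D': "D' = (if ecart q p > 0 then insert q D else D)"
    and M': "M' = (if ecart q p > 0 then insert (q, h, r) M else M)"
  shows "invariant (Run D' M' h' q' r') \<and>
    (rank (Run D' M' h' q' r'), rank (Run D M h q r)) \<in> less_than <*lex*> less_than"
proof (cases "ecart q p > 0")
  case True
  have "0 < ecart q p'" if "p' \<in> D" "term_dvd (initial_term v w lt p') (initial_term v w lt q)" for p'
    using chosen that True unfolding chosen_divisor_def is_arg_min_linorder by fastforce
  from rank_record[OF inv q this] invariant_advance(2)[OF inv q sound later] True show ?thesis
    unfolding D' M' by simp
next
  case False
  with rank_shrink[OF shrink] invariant_advance(1)[OF inv q sound later] show ?thesis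
    unfolding D' M' by simp
qed

lemma div_step_preserves_invariant:
  assumes "div_step v w lt g s C C'" and "invariant C"
  shows "invariant C' \<and> (rank C', rank C) \<in> less_than <*lex*> less_than"
  using assms
proof (cases rule: div_step.cases)
  case (no_divisor q D M h r)
  note inv = \<open>invariant C\<close>[unfolded no_divisor(1)]
  have sound: "sound (q - initial_term v w lt q) h (r + initial_term v w lt q)"
    using inv no_divisor by (intro sound_remainder_step) auto
  have later: "terms_in (after (key q)) (q - initial_term v w lt q)"
    using \<open>q \<noteq> 0\<close> by (rule terms_in_minus_initial_term)
  show ?thesis
    unfolding no_divisor(1,2)
    using invariant_advance(2)[OF inv \<open>q \<noteq> 0\<close> sound later] rank_record[OF inv \<open>q \<noteq> 0\<close>] no_divisor by blast
next
  case (by_input q D p D' M' h r M c k)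
  note inv = \<open>invariant C\<close>[unfolded by_input(1)] and c = \<open>c = term_quot _ _\<close>
  have sq: "sound q h r" using inv by simp
  have dvd: "term_dvd (initial_term v w lt p) (initial_term v w lt q)"
    using by_input by (auto simp: chosen_divisor_def is_arg_min_def)
  have sound: "sound (q - c *s p) (h(k := h k + c)) r"
    using sq \<open>q \<noteq> 0\<close> \<open>k \<in> {1..s}\<close> dvd c unfolding \<open>p = g k\<close> by (rule sound_input_step)
  obtain \<gamma> a where a: "p \<noteq> 0" "a \<noteq> 0" "c = Poly_Mapping.single \<gamma> a"
      "lm q = (\<gamma> + fst (lm p), snd (lm p))" "coefficient q (lm q) = a * coefficient p (lm p)"
    unfolding c using \<open>q \<noteq> 0\<close> dvd by (rule term_dvd_initial_termE)
  have later: "terms_in (after (key q)) (q - c *s p)"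
    unfolding a(3) using a by (intro terms_in_multiple(2))
  have shrink: "supp (q - c *s p) \<subset> supp q" if "ecart q p = 0"
    using \<open>q \<noteq> 0\<close> soundD(2)[OF sq] dvd that c by (rule supp_shrinks)
  show ?thesis
    unfolding by_input(1,2)
    by (rule division_step[OF inv \<open>q \<noteq> 0\<close> \<open>chosen_divisor v w lt D q p\<close> sound later shrink])
      (use by_input in simp_all)
next
  case (by_earlier q D p D' M' h r M c h\<^sub>m r\<^sub>m E)
  note inv = \<open>invariant C\<close>[unfolded by_earlier(1)] and c = \<open>c = term_quot _ _\<close>
  have sq: "sound q h r" using inv by simp
  have dvd: "term_dvd (initial_term v w lt p) (initial_term v w lt q)"
    using by_earlier by (auto simp: chosen_divisor_def is_arg_min_def)
  obtain a where a: "p \<noteq> 0" "sound p h\<^sub>m r\<^sub>m" "a \<noteq> 0" "0 < v a" "c = Poly_Mapping.single 0 a" "lm q = lm p"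
      "coefficient q (lm q) = a * coefficient p (lm p)"
    unfolding c using inv \<open>q \<noteq> 0\<close> \<open>(p, h\<^sub>m, r\<^sub>m) \<in> M\<close> dvd by (rule earlier_divisorE)
  note step = sound_earlier_step[OF sq a(2,4,5) \<open>E * (1 - c) = 1\<close>]
  have "terms_in (after (key q)) (q - c *s p)"
    unfolding a(5) using a by (intro terms_in_multiple(2)) simp_all
  then have later: "terms_in (after (key q)) (E *s (q - c *s p))"
    unfolding step(2) using v_inverse[OF v_one_minus[OF a(4)]]
    by (intro terms_in_smult_scalar up_closed_after) simp_all
  have shrink: "supp (E *s (q - c *s p)) \<subset> supp q" if "ecart q p = 0"
    unfolding step(2)
    using supp_shrinks[OF \<open>q \<noteq> 0\<close> soundD(2)[OF sq] dvd that c] supp_smult_scalar_subset by blast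
  show ?thesis
    unfolding by_earlier(1,2)
    by (rule division_step[OF inv \<open>q \<noteq> 0\<close> \<open>chosen_divisor v w lt D q p\<close> step(1) later shrink])
      (use by_earlier in simp_all)
next
  case (not_invertible q D p c M h r)
  note inv = \<open>invariant C\<close>[unfolded not_invertible(1)] and c = \<open>c = term_quot _ _\<close>
  have dvd: "term_dvd (initial_term v w lt p) (initial_term v w lt q)" and "p \<in> D"
    using not_invertible by (auto simp: chosen_divisor_def is_arg_min_def)
  then obtain h\<^sub>m r\<^sub>m where "(p, h\<^sub>m, r\<^sub>m) \<in> M"
    using inv \<open>p \<notin> g ` {1..s}\<close> by auto
  then obtain a where a: "0 < v a" "c = Poly_Mapping.single 0 a"
    unfolding c using inv \<open>q \<noteq> 0\<close> dvd by (metis earlier_divisorE)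
  \<comment> \<open>The divisor is an earlier dividend, so \<open>1 - c\<close> is a nonzero scalar and this case cannot occur.\<close>
  have "1 - a \<noteq> 0"
    using v_one_minus[OF a(1)] v_eq_infinity_iff[of "1 - a"] by auto
  then have "1 = (1 - c) * Poly_Mapping.single 0 (inverse (1 - a))"
    by (simp add: a(2) mult_single flip: single_diff single_one)
  then have "(1 - c) dvd 1" by (rule dvdI)
  with not_invertible show ?thesis by simp
qed

section \<open>The result of a terminated run\<close>

text \<open>
  A run cannot get stuck with a nonzero dividend: the ecart is a natural number, so some
  divisor minimizes it, and every divisor that is not an input was stored together with its \<open>h\<close> and \<open>r\<close>.
\<close>

lemma div_step_exists:
  assumes inv: "invariant (Run D M h q r)" and q: "q \<noteq> 0"
  shows "\<exists>C'. div_step v w lt g s (Run D M h q r) C'"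
proof (cases "\<exists>p\<in>D. term_dvd (initial_term v w lt p) (initial_term v w lt q)")
  case False
  with q show ?thesis by (blast intro: div_step.no_divisor)
next
  case True
  then obtain p\<^sub>0 where "p\<^sub>0 \<in> D \<and> term_dvd (initial_term v w lt p\<^sub>0) (initial_term v w lt q)" by blast
  then have "\<exists>p. chosen_divisor v w lt D q p"
    unfolding chosen_divisor_def by - (rule exI, rule is_arg_min_arg_min_nat)
  then obtain p where p: "chosen_divisor v w lt D q p" ..
  then have "p \<in> D" by (simp add: chosen_divisor_def is_arg_min_def)
  define c where "c = term_quot (initial_term v w lt q) (initial_term v w lt p)"
  consider k where "k \<in> {1..s}" "p = g k"
    | "p \<notin> g ` {1..s}" "\<not> (1 - c) dvd 1"
    | h\<^sub>m r\<^sub>m E where "p \<notin> g ` {1..s}" "(p, h\<^sub>m, r\<^sub>m) \<in> M" "E * (1 - c) = 1"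
  proof (cases "p \<in> g ` {1..s}")
    case True
    with that(1) show thesis by blast
  next
    case False
    with inv \<open>p \<in> D\<close> obtain h\<^sub>m r\<^sub>m where "(p, h\<^sub>m, r\<^sub>m) \<in> M" by auto
    with False that(2,3) show thesis by (metis dvdE mult.commute)
  qed
  then show ?thesis
  proof cases
    case 1
    with div_step.by_input[OF q p refl refl c_def] show ?thesis by blast
  next
    case 2
    with div_step.not_invertible[OF q p c_def] show ?thesis by blast
  next
    case 3
    with div_step.by_earlier[OF q p refl refl c_def] show ?thesis by blast
  qed
qed

lemma no_infinite_run:
  "\<nexists>S. S 0 = initial_config g s f \<and> (\<forall>t::nat. div_step v w lt g s (S t) (S (Suc t)))"
proof
  assume "\<exists>S. S 0 = initial_config g s f \<and> (\<forall>t::nat. div_step v w lt g s (S t) (S (Suc t)))"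
  then obtain S where S0: "S 0 = initial_config g s f"
    and step: "\<And>t::nat. div_step v w lt g s (S t) (S (Suc t))" by blast
  have "invariant (S t)" for t
    by (induction t) (use S0 invariant_initial step div_step_preserves_invariant in auto)
  then have "(rank (S (Suc t)), rank (S t)) \<in> less_than <*lex*> less_than" for t
    using step div_step_preserves_invariant by blast
  then have "\<exists>R. \<forall>t. (R (Suc t), R t) \<in> less_than <*lex*> less_than"
    by (intro exI[of _ "\<lambda>t. rank (S t)"]) blast
  moreover have "wf (less_than <*lex*> less_than)" by (intro wf_lex_prod wf_less_than)
  ultimately show False unfolding wf_iff_no_infinite_down_chain by blast
qed

lemma invariant_reachable:
  assumes "(div_step v w lt g s)\<^sup>*\<^sup>* (initial_config g s f) C"
  shows "invariant C"
  using assms by induction (use invariant_initial div_step_preserves_invariant in auto)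

lemma term_ge_of_terms_in_admissible:
  assumes "terms_in admissible x"
  shows "term_ge v w lt (initial_term v w lt x) (initial_term v w lt f)"
proof (rule term_ge_initial_term)
  show "terms_in (insert (key f) (after (key f))) x" if "f \<noteq> 0"
    using assms that by (simp add: admissible_def)
  show "x = 0" if "f = 0"
  proof -
    have "admissible = {}" unfolding admissible_def using that by (rule if_P)
    then have "supp x = {}" using assms by (auto simp: terms_in_def)
    then show ?thesis by (simp only: supp_eq_empty_iff)
  qed
qed

end

theorem theorem3p9:
  fixes v :: "'k::field \<Rightarrow> ereal"
    and w :: "real ^ 'n::finite"
    and lt :: "'n expo \<Rightarrow> 'n expo \<Rightarrow> bool"
    and f :: "('n, 'k, 'd::{finite, linorder}) pmod"
    and g :: "nat \<Rightarrow> ('n, 'k, 'd) pmod"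
    and s :: nat
  assumes "valuation v"
    and "\<forall>i. w $ i \<in> value_group v"
    and "monomial_order lt"
    and "homogeneous f"
    and "\<forall>i\<in>{1..s}. homogeneous (g i)"
  shows "(\<nexists>S. S 0 = initial_config g s f \<and> (\<forall>t::nat. div_step v w lt g s (S t) (S (Suc t)))) \<and>
    (\<forall>C. (div_step v w lt g s)\<^sup>*\<^sup>* (initial_config g s f) C \<and> (\<nexists>C'. div_step v w lt g s C C') \<longrightarrow>
       (\<exists>D M h r. C = Run D M h 0 r \<and>
          f = (\<Sum>i=1..s. h i *s g i) + r \<and>
          term_ge v w lt (initial_term v w lt r) (initial_term v w lt f) \<and>
          (\<forall>i\<in>{1..s}. term_ge v w lt (initial_term v w lt (h i *s g i)) (initial_term v w lt f)) \<and>
          (\<forall>i\<in>{1..s}. \<forall>m\<in>supp r. \<not> term_dvd (initial_term v w lt (g i)) (mterm 1 (fst m) (snd m)))))"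
proof -
  obtain e where "\<forall>m\<in>supp f. total_degree (fst m) = e"
    using \<open>homogeneous f\<close> by (auto simp: homogeneous_def)
  with assms interpret homogeneous_division v w lt f g s e
    by unfold_locales auto
  show ?thesis
  proof (intro conjI no_infinite_run allI impI)
    fix C
    assume C: "(div_step v w lt g s)\<^sup>*\<^sup>* (initial_config g s f) C \<and> (\<nexists>C'. div_step v w lt g s C C')"
    then have inv: "invariant C" using invariant_reachable by blast
    then obtain D M h q r where Run: "C = Run D M h q r" by (cases C) auto
    have "q = 0" using C inv div_step_exists unfolding Run by blast
    moreover have "sound q h r" using inv by (simp add: Run)
    ultimately have sound: "sound 0 h r" by simp
    have "f = (\<Sum>i=1..s. h i *s g i) + r" using soundD(1)[OF sound] by simp
    moreover have "\<forall>i\<in>{1..s}. \<forall>m\<in>supp r. \<not> term_dvd (initial_term v w lt (g i)) (mterm 1 (fst m) (snd m))"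
      using soundD(5)[OF sound] unfolding irreducibles_def by blast
    ultimately show "\<exists>D M h r. C = Run D M h 0 r \<and>
          f = (\<Sum>i=1..s. h i *s g i) + r \<and>
          term_ge v w lt (initial_term v w lt r) (initial_term v w lt f) \<and>
          (\<forall>i\<in>{1..s}. term_ge v w lt (initial_term v w lt (h i *s g i)) (initial_term v w lt f)) \<and>
          (\<forall>i\<in>{1..s}. \<forall>m\<in>supp r. \<not> term_dvd (initial_term v w lt (g i)) (mterm 1 (fst m) (snd m)))"
      using Run \<open>q = 0\<close> soundD(4,6)[OF sound] term_ge_of_terms_in_admissible by blast
  qed
qed

end
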